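(* Let $m$ be a positive integer. There is a randomized algorithm that, given {\textsc{SET-EVAL}} access to a distribution $D$ on $[n]$, makes at most two queries, always accepts if $D$ is $m$-grained, and rejects with probability at least $3/4$ if $D$ is not $m$-grained.
   Context: For a distribution $D$ on $[n]=\{1,\dots,n\}$ and $S\subseteq[n]$, $D(S)=\sum_{i\in S}D(i)$. A {\textsc{SET-EVAL}} oracle for $D$ takes as input any set $S\subseteq[n]$ and returns $D(S)$. A distribution $D$ is $m$-grained if $D(i)$ is an integer multiple of $1/m$ for every $i\in[n]$. *)

theory Defs
  imports "HOL-Probability.Probability"
begin

definition distribution_on :: "nat \<Rightarrow> nat pmf \<Rightarrow> bool" where
  "distribution_on n D \<longleftrightarrow> set_pmf D \<subseteq> {1..n}"

definition set_eval :: "nat pmf \<Rightarrow> nat set \<Rightarrow> real" where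
  "set_eval D S = (\<Sum>i\<in>S. pmf D i)"

definition grained :: "nat \<Rightarrow> nat \<Rightarrow> nat pmf \<Rightarrow> bool" where
  "grained m n D \<longleftrightarrow> (\<forall>i\<in>{1..n}. \<exists>k::int. pmf D i = of_int k * (1 / of_nat m))"

text \<open>
  Randomized adaptive query algorithms as well-founded trees: halt with a verdict (accept is
  \<open>True\<close>), query the oracle on a set and branch on the real answer, or draw the continuation
  from a discrete distribution. The tree itself never mentions the distribution being tested;
  the only access to it is through the answers supplied to \<open>Query\<close> nodes by \<open>execute\<close>.
\<close>

datatype set_eval_alg =
    Output bool
  | Query "nat set" "real \<Rightarrow> set_eval_alg"
  | Sample "set_eval_alg pmf"

text \<open>
  The joint law of the list of queries made and the final verdict.
\<close>

primrec execute :: "nat pmf \<Rightarrow> set_eval_alg \<Rightarrow> (nat set list \<times> bool) pmf" where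
  "execute D (Output b) = return_pmf ([], b)"
| "execute D (Query S k) = map_pmf (\<lambda>(Qs, b). (S # Qs, b)) (execute D (k (set_eval D S)))"
| "execute D (Sample p) = join_pmf (map_pmf (execute D) p)"

definition verdict :: "nat pmf \<Rightarrow> set_eval_alg \<Rightarrow> bool pmf" where
  "verdict D A = map_pmf snd (execute D A)"

end

theory Submission
  imports Defs
begin

text \<open>
  Query two independent uniformly random subsets and accept iff both answers are integer multiples
  of \<open>1/m\<close>. If \<open>D(i)\<close> is not such a multiple, then of the two sets \<open>S\<close> and \<open>S\<close> with membership of
  \<open>i\<close> toggled at most one passes the check, so a random set passes with probability at most \<open>1/2\<close>.
\<close>

text \<open>Scaling by the nonzero \<open>m\<close> turns the test into membership in
  \<open>\<int>\<close>, whose closure under sums gives completeness and whose closure under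
  differences gives soundness.\<close>

lemma grained_iff_Ints:
  assumes "m > 0"
  shows "grained m n D \<longleftrightarrow> (\<forall>i\<in>{1..n}. real m * pmf D i \<in> \<int>)"
proof -
  have "(\<exists>k::int. pmf D i = of_int k * (1 / of_nat m)) \<longleftrightarrow> real m * pmf D i \<in> \<int>" for i
    using assms by (auto simp: Ints_def field_simps)
  then show ?thesis
    by (simp add: grained_def)
qed

lemma Ints_set_eval_of_grained:
  assumes "m > 0" "grained m n D" "S \<subseteq> {1..n}"
  shows "real m * set_eval D S \<in> \<int>"
  using assms unfolding set_eval_def sum_distrib_left
  by (intro Ints_sum) (auto simp: grained_iff_Ints)

lemma card_subsets_Ints_sum_le:
  fixes f :: "'a \<Rightarrow> real"
  assumes "finite X" "i \<in> X" "f i \<notin> \<int>"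
  shows "2 * card {S \<in> Pow X. sum f S \<in> \<int>} \<le> card (Pow X)"
proof -
  let ?G = "{S \<in> Pow X. sum f S \<in> \<int>}"
  define t where "t S = (if i \<in> S then S - {i} else insert i S)" for S
  have tt: "t (t S) = S" for S
    by (auto simp: t_def)
  have disj: "?G \<inter> t ` ?G = {}"
  proof -
    have "sum f (t S) \<notin> \<int>" if S: "S \<subseteq> X" "sum f S \<in> \<int>" for S
    proof
      assume T: "sum f (t S) \<in> \<int>"
      have fin: "finite S"
        using S(1) assms(1) by (rule finite_subset)
      \<comment> \<open>Removing \<open>i\<close> lowers the sum by \<open>f i\<close> and inserting
        it raises the sum by \<open>f i\<close>; the absolute value covers both cases at once, and
        \<open>\<int>\<close> is closed under negation.\<close>
      have "\<bar>sum f S - sum f (t S)\<bar> = \<bar>f i\<bar>"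
        using fin by (auto simp: t_def sum_diff1)
      then have "\<bar>f i\<bar> \<in> \<int>"
        using S(2) T by (metis Ints_abs Ints_diff)
      then show False
        using assms(3) by (auto simp: abs_if split: if_splits)
    qed
    then show ?thesis
      by auto
  qed
  have fin: "finite ?G"
    using assms(1) by auto
  \<comment> \<open>An involution is injective.\<close>
  have "card (t ` ?G) = card ?G"
    by (rule card_image) (metis inj_onI tt)
  then have "2 * card ?G = card (?G \<union> t ` ?G)"
    using disj fin by (simp add: card_Un_disjoint)
  \<comment> \<open>Since \<open>i\<close> lies in \<open>X\<close>, toggling it keeps subsets of
    \<open>X\<close> inside \<open>X\<close>.\<close>
  also have "\<dots> \<le> card (Pow X)"
    using assms(1,2) by (intro card_mono) (auto simp: t_def split: if_splits)
  finally show ?thesis .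
qed

lemma prob_random_subset_Ints_sum_le:
  fixes f :: "'a \<Rightarrow> real"
  assumes "finite X" "i \<in> X" "f i \<notin> \<int>"
  shows "measure_pmf.prob (pmf_of_set (Pow X)) {S. sum f S \<in> \<int>} \<le> 1 / 2"
proof -
  have "Pow X \<inter> {S. sum f S \<in> \<int>} = {S \<in> Pow X. sum f S \<in> \<int>}"
    by auto
  moreover have "real (2 * card {S \<in> Pow X. sum f S \<in> \<int>}) \<le> real (card (Pow X))"
    using card_subsets_Ints_sum_le[of X i f, OF assms] by (rule of_nat_mono)
  moreover have "card (Pow X) > 0"
    using assms(1) by (auto simp: card_gt_0_iff)
  \<comment> \<open>\<open>card (Pow X)\<close> stays unevaluated so that the counting bound applies
    to it as an atom.\<close>
  ultimately show ?thesis
    using assms(1) by (subst measure_pmf_of_set) (auto simp: field_simps simp del: card_Pow)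
qed

text \<open>The tester is non-adaptive: drawing both sets in one \<open>Sample\<close> node, before
  any query, makes its execution the image of a product distribution.\<close>

definition grained_tester :: "nat \<Rightarrow> nat \<Rightarrow> set_eval_alg" where
  "grained_tester m n =
    (let U = pmf_of_set (Pow {1..n}) in
     Sample (map_pmf (\<lambda>(S, T). Query S (\<lambda>a. Query T (\<lambda>b.
       Output (real m * a \<in> \<int> \<and> real m * b \<in> \<int>)))) (pair_pmf U U)))"

lemma execute_grained_tester:
  "execute D (grained_tester m n) =
    map_pmf (\<lambda>(S, T). ([S, T], real m * set_eval D S \<in> \<int> \<and> real m * set_eval D T \<in> \<int>))
      (pair_pmf (pmf_of_set (Pow {1..n})) (pmf_of_set (Pow {1..n})))"
  by (simp add: grained_tester_def Let_def map_pmf_def[symmetric] join_eq_bind_pmf bind_map_pmf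
      case_prod_unfold)

text \<open>The query bound and perfect completeness concern every possible run, so both are read
  off the support.\<close>

lemma set_pmf_execute_grained_tester:
  "set_pmf (execute D (grained_tester m n)) =
    (\<lambda>(S, T). ([S, T], real m * set_eval D S \<in> \<int> \<and> real m * set_eval D T \<in> \<int>)) `
      (Pow {1..n} \<times> Pow {1..n})"
proof -
  have "set_pmf (pmf_of_set (Pow {1..n})) = Pow {1..n}"
    by (rule set_pmf_of_set) auto
  then show ?thesis
    by (simp add: execute_grained_tester)
qed

lemma pmf_verdict_grained_tester_True:
  "pmf (verdict D (grained_tester m n)) True =
    (measure_pmf.prob (pmf_of_set (Pow {1..n})) {S. real m * set_eval D S \<in> \<int>})\<^sup>2"
proof -
  let ?U = "pmf_of_set (Pow {1..n})" and ?G = "{S. real m * set_eval D S \<in> \<int>}"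
  let ?g = "\<lambda>(S, T). real m * set_eval D S \<in> \<int> \<and> real m * set_eval D T \<in> \<int>"
  have "verdict D (grained_tester m n) = map_pmf ?g (pair_pmf ?U ?U)"
    by (simp add: verdict_def execute_grained_tester pmf.map_comp o_def case_prod_unfold)
  then have "pmf (verdict D (grained_tester m n)) True =
      measure_pmf.prob (pair_pmf ?U ?U) (?g -` {True})"
    by (simp add: pmf_map)
  also have "?g -` {True} = ?G \<times> ?G"
    by auto
  \<comment> \<open>The product rule used next needs countable sets. \<open>?G\<close> contains
    every infinite set of naturals, on which \<open>sum\<close> defaults to 0, so it is first cut
    down to the finite support.\<close>
  also have "measure_pmf.prob (pair_pmf ?U ?U) (?G \<times> ?G) =
      measure_pmf.prob (pair_pmf ?U ?U) ((?G \<inter> set_pmf ?U) \<times> (?G \<inter> set_pmf ?U))"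
    by (subst measure_Int_set_pmf[symmetric]) (simp add: Times_Int_Times)
  also have "\<dots> = (measure_pmf.prob ?U (?G \<inter> set_pmf ?U))\<^sup>2"
    unfolding power2_eq_square by (rule measure_pmf_prob_product) auto
  also have "measure_pmf.prob ?U (?G \<inter> set_pmf ?U) = measure_pmf.prob ?U ?G"
    by (rule measure_Int_set_pmf)
  finally show ?thesis .
qed

theorem theorem4p2:
  fixes m :: nat
  assumes "m > 0"
  shows "\<exists>A :: nat \<Rightarrow> set_eval_alg. \<forall>n D. distribution_on n D \<longrightarrow>
      (\<forall>(Qs, b) \<in> set_pmf (execute D (A n)). length Qs \<le> 2 \<and> (\<forall>S\<in>set Qs. S \<subseteq> {1..n})) \<and>
      (grained m n D \<longrightarrow> (\<forall>b \<in> set_pmf (verdict D (A n)). b = True)) \<and>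
      (\<not> grained m n D \<longrightarrow> pmf (verdict D (A n)) False \<ge> 3 / 4)"
proof (intro exI[of _ "grained_tester m"] allI impI conjI)
  fix n D
  show "\<forall>(Qs, b) \<in> set_pmf (execute D (grained_tester m n)).
      length Qs \<le> 2 \<and> (\<forall>S\<in>set Qs. S \<subseteq> {1..n})"
    by (auto simp: set_pmf_execute_grained_tester)
  show "\<forall>b \<in> set_pmf (verdict D (grained_tester m n)). b = True" if "grained m n D"
    using Ints_set_eval_of_grained[OF assms that]
    by (auto simp: verdict_def set_pmf_execute_grained_tester)
  show "pmf (verdict D (grained_tester m n)) False \<ge> 3 / 4" if "\<not> grained m n D"
  proof -
    obtain i where i: "i \<in> {1..n}" "real m * pmf D i \<notin> \<int>"
      using \<open>\<not> grained m n D\<close> assms by (auto simp: grained_iff_Ints)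
    have "measure_pmf.prob (pmf_of_set (Pow {1..n})) {S. real m * set_eval D S \<in> \<int>} \<le> 1 / 2"
      using prob_random_subset_Ints_sum_le[of "{1..n}" i "\<lambda>i. real m * pmf D i"] i
      by (simp add: set_eval_def sum_distrib_left)
    then have "pmf (verdict D (grained_tester m n)) True \<le> (1 / 2)\<^sup>2"
      unfolding pmf_verdict_grained_tester_True by (rule power_mono) simp
    then show ?thesis
      \<comment> \<open>Rejection is the complementary event, and 1 - (1/2)^2 = 3/4.\<close>
      by (simp add: pmf_False_conv_True power2_eq_square)
  qed
qed

end
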